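(* Let $I\subseteq(0,\infty)$ be an open interval and let $F(K,L)$ be a differentiable production function, homogeneous of degree one, defined for $K,L>0$ with $K/L\in I$. Let $y(k)=F(K,L)/L$, $k=K/L\in I$, be the associated per-capita production function, with $y(k)>0$ and $y'(k)>0$ for all $k\in I$, and let $R(k)=\frac{y(k)}{y'(k)}-k$ be its marginal rate of substitution. Suppose there exist real constants $\lambda\neq -1$, $\mu\neq 0$ and $\theta\neq 1$ such that $$R(k)=\lambda k+\mu k^{\theta}\qquad\text{for all }k\in I.$$ Then there exists a constant $\psi>0$ such that $$y(k)=\psi\left[(1+\lambda)k^{1-\theta}+\mu\right]^{\frac{1}{(1+\lambda)(1-\theta)}}\qquad\text{for all }k\in I.$$
   Context: A production function $F(K,L)$ gives output as a function of capital $K>0$ and labor $L>0$. It is assumed homogeneous of degree one, i.e. $F(tK,tL)=tF(K,L)$ for $t>0$, so that $F(K,L)/L$ depends only on the capital-labor ratio $k=K/L$; one writes $y(k)=F(K,L)/L$. The marginal rate of substitution between $K$ and $L$ is $R=F_L/F_K$, where $F_X$ denotes the partial derivative of $F$ with respect to $X$. Under homogeneity of degree one it is a function of $k$ alone, namely $R(k)=\frac{y(k)}{y'(k)}-k$, where $y'=dy/dk$. *)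

theory Defs
  imports "HOL-Analysis.Analysis"
begin

definition input_domain :: "real set \<Rightarrow> (real \<times> real) set" where
  "input_domain I = {(K, L). K > 0 \<and> L > 0 \<and> K / L \<in> I}"

definition homogeneous_degree_one_on :: "(real \<times> real) set \<Rightarrow> (real \<times> real \<Rightarrow> real) \<Rightarrow> bool" where
  "homogeneous_degree_one_on D F \<longleftrightarrow>
     (\<forall>(K, L)\<in>D. \<forall>t>0. F (t * K, t * L) = t * F (K, L))"

text \<open>On \<open>I\<close> the function \<open>y\<close> is determined by \<open>F\<close>, namely \<open>y k = F (k, 1)\<close>; its values
  outside \<open>I\<close> are unconstrained.\<close>

definition per_capita_on :: "real set \<Rightarrow> (real \<times> real \<Rightarrow> real) \<Rightarrow> (real \<Rightarrow> real) \<Rightarrow> bool" where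
  "per_capita_on I F y \<longleftrightarrow> (\<forall>(K, L)\<in>input_domain I. y (K / L) = F (K, L) / L)"

definition mrs_per_capita :: "(real \<Rightarrow> real) \<Rightarrow> real \<Rightarrow> real" where
  "mrs_per_capita y k = y k / deriv y k - k"

text \<open>The marginal rate of substitution \<open>F\<^sub>L / F\<^sub>K\<close> in terms of the partial derivatives. For
  a differentiable \<open>F\<close> homogeneous of degree one it is the function \<open>mrs_per_capita y\<close> of the
  capital-labor ratio (lemma \<open>mrs_eq_mrs_per_capita\<close>).\<close>

definition mrs :: "(real \<times> real \<Rightarrow> real) \<Rightarrow> real \<Rightarrow> real \<Rightarrow> real" where
  "mrs F K L = deriv (\<lambda>l. F (K, l)) L / deriv (\<lambda>x. F (x, L)) K"

lemma per_capita_differentiable: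
  assumes "open I" "I \<subseteq> {0<..}"
    and F: "F differentiable_on input_domain I"
    and y: "per_capita_on I F y"
    and k: "k \<in> I"
  shows "(y has_real_derivative deriv y k) (at k)"
proof -
  have dom: "(x, 1) \<in> input_domain I" if "x \<in> I" for x
    using that assms(2) by (auto simp: input_domain_def)
  have yF: "F (x, 1) = y x" if "x \<in> I" for x
    using y dom[OF that] by (auto simp: per_capita_on_def)
  have "F differentiable (at (k, 1) within (\<lambda>x. (x, 1)) ` I)"
    by (rule differentiable_within_subset[OF F[unfolded differentiable_on_def, rule_format]])
      (use dom k in auto)
  moreover have "(\<lambda>x::real. (x, 1::real)) differentiable (at k within I)"
    unfolding differentiable_def
    by (intro exI[of _ "\<lambda>h. (h, 0)"] has_derivative_Pair has_derivative_ident has_derivative_const)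
  ultimately have "(F \<circ> (\<lambda>x. (x, 1))) differentiable (at k within I)"
    by (rule differentiable_chain_within[rotated])
  then obtain c where "((\<lambda>x. F (x, 1)) has_real_derivative c) (at k within I)"
    unfolding o_def real_differentiable_def by blast
  then have "((\<lambda>x. F (x, 1)) has_real_derivative c) (at k)"
    unfolding at_within_open[OF k assms(1)] .
  then have "(y has_real_derivative c) (at k)"
    by (rule has_field_derivative_transform_within_open[OF _ assms(1) k yF])
  with DERIV_imp_deriv[OF this] show ?thesis
    by simp
qed

lemma mrs_eq_mrs_per_capita:
  assumes I: "open I" "I \<subseteq> {0<..}"
    and F: "F differentiable_on input_domain I"
    and y: "per_capita_on I F y"
    and y': "\<And>k. k \<in> I \<Longrightarrow> deriv y k > 0"
    and KL: "(K, L) \<in> input_domain I"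
  shows "mrs F K L = mrs_per_capita y (K / L)"
proof -
  define k where "k = K / L"
  have pos: "K > 0" "L > 0" and k: "k \<in> I"
    using KL by (auto simp: input_domain_def k_def)
  have Fy: "L' * y (K' / L') = F (K', L')" if "(K', L') \<in> input_domain I" for K' L'
    using y that by (auto simp: per_capita_on_def input_domain_def)
  note dy = per_capita_differentiable[OF I F y k, unfolded k_def]
  have "((\<lambda>x. x / L) has_real_derivative 1 / L) (at K)"
    by (rule DERIV_cdivide[OF DERIV_ident])
  from DERIV_cmult[OF DERIV_chain2[OF dy this], of L]
  have "((\<lambda>x. L * y (x / L)) has_real_derivative deriv y k) (at K)"
    using pos by (simp add: k_def)
  moreover have "open ((\<lambda>x. x / L) -` I \<inter> {0<..})"
  proof -
    have "continuous_on {0<..} (\<lambda>x::real. x / L)"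
      using pos by (intro continuous_intros) auto
    from continuous_open_preimage[OF this open_greaterThan I(1)] show ?thesis
      by (simp add: Int_commute)
  qed
  ultimately have "((\<lambda>x. F (x, L)) has_real_derivative deriv y k) (at K)"
    by (rule has_field_derivative_transform_within_open)
      (use pos k in \<open>auto simp: k_def input_domain_def intro!: Fy\<close>)
  then have FK: "deriv (\<lambda>x. F (x, L)) K = deriv y k"
    by (rule DERIV_imp_deriv)
  have "((\<lambda>l. K / l) has_real_derivative - K / (L * L)) (at L)"
    using pos by (auto intro!: derivative_eq_intros)
  from DERIV_chain2[OF dy this]
  have "((\<lambda>l. y (K / l)) has_real_derivative deriv y k * (- K / (L * L))) (at L)"
    by (simp add: k_def)
  from DERIV_mult[OF DERIV_ident this]
  have "((\<lambda>l. l * y (K / l)) has_real_derivative y k - k * deriv y k) (at L)"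
    using pos by (simp add: k_def field_simps)
  moreover have "open ((\<lambda>l. K / l) -` I \<inter> {0<..})"
  proof -
    have "continuous_on {0<..} (\<lambda>l::real. K / l)"
      using pos by (intro continuous_intros) auto
    from continuous_open_preimage[OF this open_greaterThan I(1)] show ?thesis
      by (simp add: Int_commute)
  qed
  ultimately have "((\<lambda>l. F (K, l)) has_real_derivative y k - k * deriv y k) (at L)"
    by (rule has_field_derivative_transform_within_open)
      (use pos k in \<open>auto simp: k_def input_domain_def intro!: Fy\<close>)
  then have FL: "deriv (\<lambda>l. F (K, l)) L = y k - k * deriv y k"
    by (rule DERIV_imp_deriv)
  show ?thesis
    using y'[OF k] unfolding mrs_def mrs_per_capita_def FK FL k_def[symmetric]
    by (simp add: field_simps)
qed

end

(* From R = y / y' - k one gets y / y' = k powr theta * B with B = (1 + lam) * k powr (1 - theta) + mu.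
   Positivity of y and y' forces B > 0, and y' / y = k powr (- theta) / B is the logarithmic derivative
   of B powr (1 / ((1 + lam) * (1 - theta))). *)

theory Submission
  imports Defs
begin

theorem theorem1:
  fixes I :: "real set"
    and F :: "real \<times> real \<Rightarrow> real"
    and y :: "real \<Rightarrow> real"
    and lam mu theta :: real
  assumes "open I" and "is_interval I" and "I \<subseteq> {0<..}"
    and "F differentiable_on input_domain I"
    and "homogeneous_degree_one_on (input_domain I) F"
    and "per_capita_on I F y"
    and "\<And>k. k \<in> I \<Longrightarrow> y k > 0"
    and "\<And>k. k \<in> I \<Longrightarrow> deriv y k > 0"
    and "lam \<noteq> -1" and "mu \<noteq> 0" and "theta \<noteq> 1"
    and "\<And>k. k \<in> I \<Longrightarrow> mrs_per_capita y k = lam * k + mu * k powr theta"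
  shows "\<exists>psi>0. \<forall>k\<in>I.
           y k = psi * ((1 + lam) * k powr (1 - theta) + mu) powr (1 / ((1 + lam) * (1 - theta)))"
proof -
  define B where "B = (\<lambda>k. (1 + lam) * k powr (1 - theta) + mu)"
  define c where "c = 1 / ((1 + lam) * (1 - theta))"
  \<comment> \<open>Since \<open>lam\<close> differs from -1 and \<open>theta\<close> from 1, the
    denominator in \<open>c\<close> is nonzero, so \<open>c\<close> is a true reciprocal and not the
    default value of division by 0.\<close>
  have cne: "c * ((1 + lam) * (1 - theta)) = 1"
    using assms(9,11) by (simp add: c_def add_eq_0_iff2)
  have pos: "k > 0" if "k \<in> I" for k
    using that assms(3) by auto
  \<comment> \<open>Adding \<open>k\<close> to the assumed form of \<open>mrs_per_capita y k\<close>
    turns the coefficient \<open>lam\<close> into \<open>1 + lam\<close>; then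
    \<open>k powr theta\<close> is factored out.\<close>
  have ratio: "y k / deriv y k = k powr theta * B k" if k: "k \<in> I" for k
  proof -
    have "k powr theta * k powr (1 - theta) = k"
      using pos[OF k] by (simp flip: powr_add)
    then have "k powr theta * B k = (1 + lam) * k + mu * k powr theta"
      by (simp add: B_def algebra_simps)
    with assms(12)[OF k] show ?thesis
      by (simp add: mrs_per_capita_def algebra_simps)
  qed
  have Bpos: "B k > 0" if k: "k \<in> I" for k
  proof -
    have "0 < k powr theta * B k"
      using assms(7,8)[OF k] by (simp flip: ratio[OF k])
    with pos[OF k] show ?thesis
      by (simp add: zero_less_mult_iff)
  qed
  \<comment> \<open>Both logarithms have positive arguments on \<open>I\<close>, so the formula to
    be proved amounts to their combination being constant there.\<close>
  have "((\<lambda>k. ln (y k) - c * ln (B k)) has_real_derivative 0) (at k within I)" if k: "k \<in> I" for k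
  proof -
    have "1 / y k * deriv y k = k powr (- theta) / B k"
      using ratio[OF k] assms(7,8)[OF k] Bpos[OF k] pos[OF k]
      by (simp add: powr_minus field_simps)
    then have dy: "((\<lambda>k. ln (y k)) has_real_derivative k powr (- theta) / B k) (at k)"
      using DERIV_chain2[OF DERIV_ln_divide[OF assms(7)[OF k]]
          per_capita_differentiable[OF assms(1,3,4,6) k]] by simp
    have "(B has_real_derivative (1 + lam) * ((1 - theta) * k powr (- theta))) (at k)"
      unfolding B_def using pos[OF k] by (auto intro!: derivative_eq_intros has_real_derivative_powr)
    note dB = DERIV_cmult[OF DERIV_chain2[OF DERIV_ln_divide[OF Bpos[OF k]] this], of c]
    \<comment> \<open>Regrouping exposes the product that \<open>cne\<close> evaluates to 1. The
      derivative of \<open>c * ln (B k)\<close> then literally matches that of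
      \<open>ln (y k)\<close>, and the difference cancels.\<close>
    have "c * (1 / B k * ((1 + lam) * ((1 - theta) * k powr (- theta)))) =
        c * ((1 + lam) * (1 - theta)) * (k powr (- theta) / B k)"
      by simp
    also have "\<dots> = k powr (- theta) / B k"
      unfolding cne by simp
    finally have "((\<lambda>k. ln (y k) - c * ln (B k)) has_real_derivative 0) (at k)"
      using DERIV_diff[OF dy dB] by (simp only: diff_self)
    then show ?thesis
      by (rule has_field_derivative_at_within)
  qed
  \<comment> \<open>Because \<open>I\<close> is an interval, hence convex, a single constant
    \<open>d\<close> serves all of \<open>I\<close>. Exponentiating makes \<open>exp d\<close> the
    required positive factor \<open>psi\<close>.\<close>
  from has_field_derivative_zero_constant[OF is_interval_convex[OF assms(2)] this]
  obtain d where d: "\<And>k. k \<in> I \<Longrightarrow> ln (y k) - c * ln (B k) = d"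
    by blast
  have "y k = exp d * B k powr c" if k: "k \<in> I" for k
  proof -
    have "ln (y k) = d + c * ln (B k)"
      using d[OF k] by simp
    then have "y k = exp (d + c * ln (B k))"
      using assms(7)[OF k] by (metis exp_ln)
    \<comment> \<open>For \<open>B k > 0\<close>, \<open>B k powr c\<close> unfolds to
      \<open>exp (c * ln (B k))\<close>; at 0 it would be 0 by convention.\<close>
    with Bpos[OF k] show ?thesis
      by (simp add: powr_def exp_add)
  qed
  then show ?thesis
    unfolding B_def c_def by (intro exI[of _ "exp d"]) auto
qed

end
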